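(* Let $q$ be a prime power. If $f(x)\in\mathbb{F}_q[x]$ is a complete mapping of $\mathbb{F}_q$, then we have either $$\mathcal{L}(f)\ge \left\lfloor \frac{q+5}{2}\right\rfloor$$ or $$\mathrm{Crk}(f)\ge \left\lfloor \frac{q}{2}\right\rfloor .$$
   Context: $\mathbb{F}_q$ denotes the finite field with $q$ elements. A polynomial $f(x)\in\mathbb{F}_q[x]$ is a permutation polynomial if $c\mapsto f(c)$ is a bijection of $\mathbb{F}_q$. It is a complete mapping of $\mathbb{F}_q$ if both $f(x)$ and $f(x)+x$ are permutation polynomials of $\mathbb{F}_q$. The linearity of $f$ is $\mathcal{L}(f)=\max_{a,b\in\mathbb{F}_q}|\{c\in\mathbb{F}_q : f(c)=ac+b\}|$. Carlitz rank: for $q\ge 3$ the polynomial $x^{q-2}$ induces the map on $\mathbb{F}_q$ sending $0\mapsto 0$ and $x\mapsto x^{-1}$ for $x\neq 0$. For an integer $n\ge 0$ and $a_0,\dots,a_{n+1}\in\mathbb{F}_q$ with $a_i\ne 0$ for $i=0,2,\dots,n$ (while $a_1$ and $a_{n+1}$ may be arbitrary), put $$P_n(a_0,\dots,a_{n+1};x)=(\ldots((a_0x+a_1)^{q-2}+a_2)^{q-2}\ldots+a_n)^{q-2}+a_{n+1},$$ with exactly $n$ occurrences of the exponent $q-2$; for $n=0$ this is $P_0(a_0,a_1;x)=a_0x+a_1$ with $a_0\neq 0$. By a theorem of Carlitz, for $q\ge 3$ every permutation of $\mathbb{F}_q$ is induced by some such $P_n$ (for $q=2$ every permutation is already induced by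 some $P_0$). The Carlitz rank $\mathrm{Crk}(f)$ of a permutation polynomial $f$ over $\mathbb{F}_q$ is the smallest integer $n\ge 0$ such that $f$ and some permutation $P_n(a_0,\dots,a_{n+1};x)$ of this form induce the same map on $\mathbb{F}_q$.
   Formalization: The case q = 3 is excluded, because the claim fails there: every complete mapping of F_3 has the form x + b, with linearity 3 < 4 and Carlitz rank 0 < 1. *)

theory Defs
  imports "HOL-Computational_Algebra.Polynomial" "HOL-Library.Cardinality"
begin

text \<open>The finite field with \<open>q\<close> elements is a type \<open>'a :: {field, finite}\<close> with \<open>q = CARD('a)\<close>.\<close>

definition permutation_poly :: "'a::{field,finite} poly \<Rightarrow> bool" where
  "permutation_poly f \<longleftrightarrow> bij (poly f)"

definition complete_mapping :: "'a::{field,finite} poly \<Rightarrow> bool" where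
  "complete_mapping f \<longleftrightarrow> permutation_poly f \<and> permutation_poly (f + [:0, 1:])"

definition linearity :: "'a::{field,finite} poly \<Rightarrow> nat" where
  "linearity f = Max (range (\<lambda>(a, b). card {c. poly f c = a * c + b}))"

text \<open>\<open>carlitz_poly n a\<close> is \<open>P\<^sub>n(a\<^sub>0, \<dots>, a\<^sub>n\<^sub>+\<^sub>1; x)\<close>; the entries of \<open>a\<close> beyond
  index \<open>n + 1\<close> are ignored. It is built up through
  \<open>P\<^sub>n\<^sub>+\<^sub>1(a\<^sub>0, \<dots>, a\<^sub>n\<^sub>+\<^sub>2; x) = P\<^sub>n(a\<^sub>0, \<dots>, a\<^sub>n\<^sub>+\<^sub>1; x)\<close> raised to the power \<open>q - 2\<close>,
  plus \<open>a\<^sub>n\<^sub>+\<^sub>2\<close>.\<close>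

primrec carlitz_poly :: "nat \<Rightarrow> (nat \<Rightarrow> 'a::{field,finite}) \<Rightarrow> 'a poly" where
  "carlitz_poly 0 a = [:a 1, a 0:]"
| "carlitz_poly (Suc n) a = carlitz_poly n a ^ (CARD('a) - 2) + [:a (n + 2):]"

definition carlitz_coeffs :: "nat \<Rightarrow> (nat \<Rightarrow> 'a::{field,finite}) \<Rightarrow> bool" where
  "carlitz_coeffs n a \<longleftrightarrow> a 0 \<noteq> 0 \<and> (\<forall>i\<in>{2..n}. a i \<noteq> 0)"

text \<open>Meaningful for permutation polynomials only: for these, a suitable \<open>n\<close> exists by a
  theorem of Carlitz.\<close>

definition carlitz_rank :: "'a::{field,finite} poly \<Rightarrow> nat" where
  "carlitz_rank f = (LEAST n. \<exists>a. carlitz_coeffs n a \<and> permutation_poly (carlitz_poly n a) \<and>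
     poly (carlitz_poly n a) = poly f)"

end

theory Submission
  imports Defs "HOL-Combinatorics.Permutations"
begin

text \<open>
  The idea is that a permutation of small Carlitz rank is, up to few exceptions, a fractional
  linear map. Since \<open>x\<^sup>q\<^sup>-\<^sup>2\<close> is inversion away from \<open>0\<close>, unfolding \<open>P\<^sub>n\<close> gives
  \<open>P\<^sub>n(c) = (\<alpha>c + \<beta>) / (\<gamma>c + \<delta>)\<close> for all \<open>c\<close> outside the set of the at most \<open>n\<close> poles
  of the intermediate fractions (\<open>carlitz_poly_fractional_linear\<close>). Let \<open>n < \<lfloor>q/2\<rfloor>\<close>
  be the Carlitz rank of the complete mapping \<open>f\<close>.

  If \<open>\<gamma> = 0\<close>, then \<open>f\<close> is affine off the poles. The last pole is then at infinity, so that
  for \<open>n \<ge> 1\<close> at most \<open>n - 1\<close> elements of the field are lost, and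
  \<open>q - n + 1 \<ge> \<lfloor>(q + 5)/2\<rfloor>\<close>.

  If \<open>\<gamma> \<noteq> 0\<close>, the substitution \<open>u = x + \<delta>/\<gamma>\<close> turns \<open>f(x) + x\<close>, off the poles, into
  \<open>u + D/u\<close> plus a constant, with \<open>D \<noteq> 0\<close>. This expression does not distinguish \<open>u\<close> from
  \<open>D/u\<close>, so it can be injective on at most \<open>(q + 1)/2\<close> elements
  (\<open>card_le_if_inj_on_fractional_linear_plus_id\<close>). As \<open>f(x) + x\<close> is injective, this contradicts
  the number \<open>q - n\<close> of elements outside the poles.

  The argument starts from a representation of \<open>f\<close> of length equal to its Carlitz rank.
  Such a representation exists by Carlitz's theorem (\<open>carlitz_representation\<close>), which reduces to
  writing a transposition as a composition of affine maps and inversions.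
\<close>

section \<open>Inversion as a power map\<close>

lemma finite_field_power_card_minus_one:
  fixes x :: "'a::{field,finite}"
  assumes "x \<noteq> 0"
  shows "x ^ (CARD('a) - 1) = 1"
proof -
  let ?U = "UNIV - {0::'a}"
  have "bij_betw ((*) x) ?U ?U"
    using assms by (intro bij_betw_byWitness[where f' = "(*) (inverse x)"]) (auto simp: field_simps)
  then have "(\<Prod>y\<in>?U. x * y) = (\<Prod>y\<in>?U. y)"
    by (rule prod.reindex_bij_betw)
  moreover have "(\<Prod>y\<in>?U. x * y) = x ^ (CARD('a) - 1) * (\<Prod>y\<in>?U. y)"
    by (simp add: prod.distrib)
  moreover have "(\<Prod>y\<in>?U. y) \<noteq> 0"
    by simp
  ultimately show ?thesis
    by simp
qed

text \<open>For \<open>q = 2\<close> the left-hand side is the constant \<open>1\<close>, which differs from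
  \<open>inverse 0 = 0\<close> at \<open>x = 0\<close>.\<close>

lemma finite_field_power_card_minus_two:
  fixes x :: "'a::{field,finite}"
  assumes "CARD('a) \<ge> 3"
  shows "x ^ (CARD('a) - 2) = inverse x"
proof (cases "x = 0")
  case True
  then show ?thesis using assms by simp
next
  case False
  have "x * x ^ (CARD('a) - 2) = x ^ (CARD('a) - 1)"
    using assms by (simp add: Suc_diff_Suc numeral_2_eq_2 flip: power_Suc)
  then have "x * x ^ (CARD('a) - 2) = 1"
    using finite_field_power_card_minus_one[OF False] by simp
  then show ?thesis by (simp add: inverse_unique)
qed

lemma poly_carlitz_poly_Suc:
  fixes a :: "nat \<Rightarrow> 'a::{field,finite}"
  assumes "CARD('a) \<ge> 3"
  shows "poly (carlitz_poly (Suc n) a) x = inverse (poly (carlitz_poly n a) x) + a (n + 2)"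
  using finite_field_power_card_minus_two[OF assms] by (simp add: poly_power)

section \<open>Carlitz's theorem\<close>

definition carlitz_maps :: "('a::{field,finite} \<Rightarrow> 'a) set" where
  "carlitz_maps = {poly (carlitz_poly n a) | n a. carlitz_coeffs n a}"

lemma carlitz_poly_cong:
  "(\<And>i. i \<le> n + 1 \<Longrightarrow> a i = b i) \<Longrightarrow> carlitz_poly n a = carlitz_poly n b"
  by (induction n) simp_all

text \<open>Extending a representation by one inversion makes its former last coefficient an inner
  one, which must not vanish unless \<open>n = 0\<close>.\<close>

lemma carlitz_maps_inverse_plus:
  fixes a :: "nat \<Rightarrow> 'a::{field,finite}"
  assumes "CARD('a) \<ge> 3" and "carlitz_coeffs n a" and "n = 0 \<or> a (n + 1) \<noteq> 0"
  shows "(\<lambda>x. inverse (poly (carlitz_poly n a) x) + b) \<in> carlitz_maps"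
proof -
  let ?a = "a(n + 2 := b)"
  have "carlitz_coeffs (Suc n) ?a"
    using assms(2,3) by (auto simp: carlitz_coeffs_def le_Suc_eq)
  moreover have "carlitz_poly n ?a = carlitz_poly n a"
    by (rule carlitz_poly_cong) simp
  then have "(\<lambda>x. inverse (poly (carlitz_poly n a) x) + b) = poly (carlitz_poly (Suc n) ?a)"
    by (simp add: fun_eq_iff poly_carlitz_poly_Suc[OF assms(1)] del: carlitz_poly.simps)
  ultimately show ?thesis
    unfolding carlitz_maps_def by blast
qed

text \<open>A vanishing last coefficient is dealt with by cancelling the two consecutive inversions.\<close>

lemma carlitz_maps_inverse:
  fixes g :: "'a::{field,finite} \<Rightarrow> 'a"
  assumes q: "CARD('a) \<ge> 3" and "g \<in> carlitz_maps"
  shows "(\<lambda>x. inverse (g x)) \<in> carlitz_maps"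
proof -
  obtain n a where g: "g = poly (carlitz_poly n a)" and a: "carlitz_coeffs n a"
    using assms(2) unfolding carlitz_maps_def by blast
  show ?thesis
  proof (cases "n = 0 \<or> a (n + 1) \<noteq> 0")
    case True
    then show ?thesis
      using carlitz_maps_inverse_plus[OF q a True, of 0] g by simp
  next
    case False
    then obtain m where m: "n = Suc m" and "a (m + 2) = 0"
      by (cases n) auto
    then have "(\<lambda>x. inverse (g x)) = poly (carlitz_poly m a)"
      by (simp add: g fun_eq_iff poly_carlitz_poly_Suc[OF q] del: carlitz_poly.simps)
    moreover have "carlitz_coeffs m a"
      using a m by (auto simp: carlitz_coeffs_def)
    ultimately show ?thesis
      unfolding carlitz_maps_def by blast
  qed
qed

lemma carlitz_maps_plus:
  fixes g :: "'a::{field,finite} \<Rightarrow> 'a"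
  assumes q: "CARD('a) \<ge> 3" and "g \<in> carlitz_maps"
  shows "(\<lambda>x. g x + b) \<in> carlitz_maps"
proof -
  obtain n a where g: "g = poly (carlitz_poly n a)" and a: "carlitz_coeffs n a"
    using assms(2) unfolding carlitz_maps_def by blast
  let ?a = "a(n + 1 := a (n + 1) + b)"
  have "(\<lambda>x. g x + b) = poly (carlitz_poly n ?a)"
  proof (cases n)
    case 0
    then show ?thesis by (simp add: g fun_eq_iff)
  next
    case (Suc m)
    have "carlitz_poly m ?a = carlitz_poly m a"
      by (rule carlitz_poly_cong) (simp add: Suc)
    then show ?thesis
      by (simp add: g Suc fun_eq_iff poly_carlitz_poly_Suc[OF q] del: carlitz_poly.simps)
  qed
  moreover have "carlitz_coeffs n ?a"
    using a by (auto simp: carlitz_coeffs_def)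
  ultimately show ?thesis
    unfolding carlitz_maps_def by blast
qed

text \<open>A factor is moved inwards by \<open>s (y\<^sup>-\<^sup>1 + b) = (s\<^sup>-\<^sup>1 y)\<^sup>-\<^sup>1 + s b\<close>, so it
  multiplies the coefficients alternately by \<open>s\<close> and \<open>s\<^sup>-\<^sup>1\<close>. Tracking the last
  coefficient keeps the induction going.\<close>

lemma carlitz_poly_scale:
  fixes a :: "nat \<Rightarrow> 'a::{field,finite}"
  assumes q: "CARD('a) \<ge> 3" and "carlitz_coeffs n a" and "s \<noteq> 0"
  shows "\<exists>b. carlitz_coeffs n b \<and> b (n + 1) = s * a (n + 1) \<and>
    (\<forall>x. poly (carlitz_poly n b) x = s * poly (carlitz_poly n a) x)"
  using assms(2,3)
proof (induction n arbitrary: s)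
  case 0
  then show ?case
    by (intro exI[of _ "\<lambda>i. s * a i"]) (auto simp: carlitz_coeffs_def algebra_simps)
next
  case (Suc n)
  have "carlitz_coeffs n a"
    using Suc.prems(1) by (auto simp: carlitz_coeffs_def)
  then obtain b where b: "carlitz_coeffs n b" "b (n + 1) = inverse s * a (n + 1)"
    "\<And>x. poly (carlitz_poly n b) x = inverse s * poly (carlitz_poly n a) x"
    using Suc.IH[of "inverse s"] Suc.prems(2) by auto
  let ?b = "b(n + 2 := s * a (n + 2))"
  have "carlitz_coeffs (Suc n) ?b"
    using Suc.prems b(1,2) by (auto simp: carlitz_coeffs_def le_Suc_eq)
  moreover have "carlitz_poly n ?b = carlitz_poly n b"
    by (rule carlitz_poly_cong) simp
  then have "poly (carlitz_poly (Suc n) ?b) x = s * poly (carlitz_poly (Suc n) a) x" for x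
    by (simp add: poly_carlitz_poly_Suc[OF q] b(3) distrib_left inverse_mult_distrib
        del: carlitz_poly.simps)
  ultimately show ?case
    by (intro exI[of _ ?b]) (simp del: carlitz_poly.simps fun_upd_apply add: fun_upd_same)
qed

lemma carlitz_maps_times:
  fixes g :: "'a::{field,finite} \<Rightarrow> 'a"
  assumes q: "CARD('a) \<ge> 3" and "g \<in> carlitz_maps" and "s \<noteq> 0"
  shows "(\<lambda>x. s * g x) \<in> carlitz_maps"
proof -
  obtain n a where g: "g = poly (carlitz_poly n a)" and a: "carlitz_coeffs n a"
    using assms(2) unfolding carlitz_maps_def by blast
  obtain b where "carlitz_coeffs n b" "\<forall>x. poly (carlitz_poly n b) x = s * g x"
    using carlitz_poly_scale[OF q a assms(3)] g by blast
  then have "(\<lambda>x. s * g x) = poly (carlitz_poly n b)"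
    by (simp add: fun_eq_iff)
  with \<open>carlitz_coeffs n b\<close> show ?thesis
    unfolding carlitz_maps_def by blast
qed

text \<open>With \<open>d = v - u\<close> and \<open>z = y - u\<close>, this is Carlitz's formula for the transposition of
  \<open>0\<close> and \<open>d\<close>: away from these two points the nested inversions are
  \<open>z \<mapsto> z / (d (z - d)) \<mapsto> - d\<^sup>2 / z \<mapsto> - z / d\<^sup>2\<close>, and the convention
  \<open>inverse 0 = 0\<close> causes the exchange at \<open>0\<close> and \<open>d\<close>.\<close>

lemma transpose_eq_nested_inverses:
  fixes u v y :: "'a::field"
  assumes "u \<noteq> v"
  shows "transpose u v y =
    - ((v - u)^2) * inverse (inverse (inverse (y + - v) + inverse (v - u)) + - (v - u)) + u"
proof -
  define d where "d = v - u"
  define z where "z = y - u"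
  have d: "d \<noteq> 0" using assms by (simp add: d_def)
  have v: "v = u + d" and y: "y = u + z"
    by (simp_all add: d_def z_def)
  consider "z = 0" | "z = d" | "z \<noteq> 0" "z \<noteq> d" by blast
  then have "transpose u v y = - (d^2) * inverse (inverse (inverse (z - d) + inverse d) - d) + u"
  proof cases
    case 1
    then show ?thesis using d by (simp add: v y power2_eq_square)
  next
    case 2
    then show ?thesis using d by (simp add: v y)
  next
    case 3
    have sum: "inverse (z - d) + inverse d = z / (d * (z - d))"
      using 3 d by (simp add: field_simps)
    have diff: "inverse (z / (d * (z - d))) - d = - (d^2) / z"
      using 3 d by (simp add: field_simps power2_eq_square)
    have "- (d^2) * inverse (inverse (inverse (z - d) + inverse d) - d) = z"
      unfolding sum diff using 3 d by (simp add: field_simps)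
    then show ?thesis using 3 by (simp add: v y transpose_def)
  qed
  then show ?thesis by (simp add: v y)
qed

lemma carlitz_maps_transpose:
  fixes g :: "'a::{field,finite} \<Rightarrow> 'a"
  assumes q: "CARD('a) \<ge> 3" and g: "g \<in> carlitz_maps" and "u \<noteq> v"
  shows "transpose u v \<circ> g \<in> carlitz_maps"
proof -
  have "- ((v - u)^2) \<noteq> 0" using assms(3) by simp
  then have "(\<lambda>x. - ((v - u)^2) * inverse (inverse (inverse (g x + - v) + inverse (v - u))
      + - (v - u)) + u) \<in> carlitz_maps"
    by (intro carlitz_maps_plus[OF q] carlitz_maps_times[OF q] carlitz_maps_inverse[OF q] g)
  then show ?thesis
    unfolding comp_def transpose_eq_nested_inverses[OF assms(3)] .
qed

text \<open>Transpositions generate the symmetric group.\<close>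

theorem carlitz_representation:
  fixes p :: "'a::{field,finite} \<Rightarrow> 'a"
  assumes q: "CARD('a) \<ge> 3" and "bij p"
  obtains n a where "carlitz_coeffs n a" and "poly (carlitz_poly n a) = p"
proof -
  have id: "id \<in> (carlitz_maps :: ('a \<Rightarrow> 'a) set)"
    unfolding carlitz_maps_def mem_Collect_eq
    by (intro exI[of _ 0] exI[of _ "\<lambda>i. if i = 0 then 1 else 0"])
      (auto simp: carlitz_coeffs_def fun_eq_iff)
  have "p permutes UNIV"
    using assms(2) by (simp add: permutes_univ bij_iff)
  then have "p \<in> carlitz_maps"
    using finite[of UNIV] by (induction rule: permutes_induct) (simp_all only: id carlitz_maps_transpose[OF q] not_False_eq_True)
  then show thesis
    using that unfolding carlitz_maps_def by auto
qed

lemma carlitz_rank_attained: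
  fixes f :: "'a::{field,finite} poly"
  assumes "CARD('a) \<ge> 3" and "permutation_poly f"
  obtains a where "carlitz_coeffs (carlitz_rank f) a"
    and "poly (carlitz_poly (carlitz_rank f) a) = poly f"
proof -
  have "bij (poly f)" using assms(2) by (simp add: permutation_poly_def)
  from carlitz_representation[OF assms(1) this]
  have "\<exists>n a. carlitz_coeffs n a \<and> permutation_poly (carlitz_poly n a) \<and>
      poly (carlitz_poly n a) = poly f"
    using \<open>bij (poly f)\<close> unfolding permutation_poly_def by metis
  from LeastI_ex[OF this] show thesis
    using that unfolding carlitz_rank_def[symmetric] by blast
qed

section \<open>Fractional linear behaviour outside the poles\<close>

text \<open>Inverting \<open>(\<alpha>c + \<beta>) / (\<gamma>c + \<delta>)\<close> and adding a constant creates the pole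
  \<open>- \<beta> / \<alpha>\<close> if \<open>\<alpha> \<noteq> 0\<close>, and no pole in the field if \<open>\<alpha> = 0\<close>. In the latter case
  the new denominator is constant, which gives the sharper bound \<open>n - 1\<close>; the truncated
  subtraction makes this bound correct for \<open>n = 0\<close> as well.\<close>

lemma carlitz_poly_fractional_linear:
  fixes a :: "nat \<Rightarrow> 'a::{field,finite}"
  assumes q: "CARD('a) \<ge> 3" and "a 0 \<noteq> 0"
  shows "\<exists>\<alpha> \<beta> \<gamma> \<delta> E. \<alpha> * \<delta> - \<beta> * \<gamma> \<noteq> 0 \<and>
    card E \<le> (if \<gamma> = 0 then n - 1 else n) \<and>
    (\<forall>c. c \<notin> E \<longrightarrow> \<gamma> * c + \<delta> \<noteq> 0 \<and>
      poly (carlitz_poly n a) c = (\<alpha> * c + \<beta>) / (\<gamma> * c + \<delta>))"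
proof (induction n)
  case 0
  show ?case
    using assms(2)
    by (intro exI[of _ "a 0"] exI[of _ "a 1"] exI[of _ 0] exI[of _ 1] exI[of _ "{}"]) simp
next
  case (Suc n)
  then obtain \<alpha> \<beta> \<gamma> \<delta> E where det: "\<alpha> * \<delta> - \<beta> * \<gamma> \<noteq> 0"
    and card: "card E \<le> (if \<gamma> = 0 then n - 1 else n)"
    and eq: "\<And>c. c \<notin> E \<Longrightarrow> \<gamma> * c + \<delta> \<noteq> 0 \<and>
      poly (carlitz_poly n a) c = (\<alpha> * c + \<beta>) / (\<gamma> * c + \<delta>)"
    by blast
  let ?b = "a (n + 2)"
  define E' where "E' = (if \<alpha> = 0 then E else insert (- \<beta> / \<alpha>) E)"
  have "(\<gamma> + ?b * \<alpha>) * \<beta> - (\<delta> + ?b * \<beta>) * \<alpha> = - (\<alpha> * \<delta> - \<beta> * \<gamma>)"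
    by (simp add: algebra_simps)
  then have "(\<gamma> + ?b * \<alpha>) * \<beta> - (\<delta> + ?b * \<beta>) * \<alpha> \<noteq> 0"
    using det by simp
  moreover have "card E \<le> n"
    using card by (simp split: if_splits)
  then have "card E' \<le> (if \<alpha> = 0 then Suc n - 1 else Suc n)"
    using card_insert_le_m1[of "Suc n" E] by (simp add: E'_def)
  moreover have "\<alpha> * c + \<beta> \<noteq> 0 \<and> poly (carlitz_poly (Suc n) a) c =
      ((\<gamma> + ?b * \<alpha>) * c + (\<delta> + ?b * \<beta>)) / (\<alpha> * c + \<beta>)" if c: "c \<notin> E'" for c
  proof -
    have "c \<notin> E" using c by (auto simp: E'_def split: if_splits)
    have nz: "\<alpha> * c + \<beta> \<noteq> 0"
    proof (cases "\<alpha> = 0")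
      case True
      then show ?thesis using det by auto
    next
      case False
      then have "c \<noteq> - \<beta> / \<alpha>" using c by (simp add: E'_def)
      then show ?thesis using False by (auto simp: field_simps add_eq_0_iff)
    qed
    have "poly (carlitz_poly (Suc n) a) c = (\<gamma> * c + \<delta>) / (\<alpha> * c + \<beta>) + ?b"
      using eq[OF \<open>c \<notin> E\<close>] by (simp add: poly_carlitz_poly_Suc[OF q] del: carlitz_poly.simps)
    also have "\<dots> = ((\<gamma> + ?b * \<alpha>) * c + (\<delta> + ?b * \<beta>)) / (\<alpha> * c + \<beta>)"
      using nz by (simp add: field_simps)
    finally show ?thesis using nz by blast
  qed
  ultimately show ?case
    by blast
qed

section \<open>Counting\<close>

lemma card_square_roots_le_2:
  fixes D :: "'a::{field,finite}"
  shows "card {u. u * u = D} \<le> 2"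
proof (cases "\<exists>u. u * u = D")
  case True
  then obtain u where D: "D = u * u" by auto
  have "{u. u * u = D} \<subseteq> {u, - u}"
    unfolding D square_eq_iff by auto
  then have "card {u. u * u = D} \<le> card {u, - u}"
    by (intro card_mono) auto
  also have "\<dots> \<le> 2"
    by (simp add: card_insert_if)
  finally show ?thesis .
qed simp

text \<open>The set \<open>T\<close> and its image under the involution \<open>u \<mapsto> D/u\<close> lie in the \<open>q - 1\<close>
  nonzero elements and meet only in the at most two fixed points of the involution.\<close>

lemma card_le_if_inj_on_plus_divide:
  fixes D :: "'a::{field,finite}"
  assumes "D \<noteq> 0" and "0 \<notin> T" and inj: "inj_on (\<lambda>u. u + D / u) T"
  shows "2 * card T \<le> CARD('a) + 1"
proof -
  let ?T' = "(\<lambda>u. D / u) ` T"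
  have "inj_on (\<lambda>u. D / u) T"
    using assms(1,2) by (auto simp: inj_on_def field_simps)
  then have "2 * card T = card T + card ?T'"
    by (simp add: card_image)
  also have "\<dots> = card (T \<union> ?T') + card (T \<inter> ?T')"
    by (rule card_Un_Int) auto
  finally have "2 * card T = card (T \<union> ?T') + card (T \<inter> ?T')" .
  moreover have "T \<inter> ?T' \<subseteq> {u. u * u = D}"
  proof
    fix u assume "u \<in> T \<inter> ?T'"
    then obtain v where uv: "u \<in> T" "v \<in> T" "u = D / v" by blast
    then have "v \<noteq> 0" using assms(2) by auto
    then have "D / u = v"
      using uv(3) assms(1) by simp
    then have "u + D / u = v + D / v"
      unfolding uv(3)[symmetric] by (simp add: add.commute)
    then have "u = v" using inj_onD[OF inj] uv(1,2) by blast
    moreover have "u * v = D" using uv(3) \<open>v \<noteq> 0\<close> by simp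
    ultimately show "u \<in> {u. u * u = D}" by simp
  qed
  then have "card (T \<inter> ?T') \<le> 2"
    using card_mono[of "{u. u * u = D}" "T \<inter> ?T'"] card_square_roots_le_2[of D] by simp
  moreover have "T \<union> ?T' \<subseteq> UNIV - {0}"
    using assms(1,2) by auto
  then have "card (T \<union> ?T') \<le> CARD('a) - 1"
    using card_mono[of "UNIV - {0}" "T \<union> ?T'"] by simp
  moreover have "CARD('a) > 0" by simp
  ultimately show ?thesis by linarith
qed

text \<open>The shift \<open>u = c + \<delta>/\<gamma>\<close> moves the pole to \<open>0\<close>; the numerator of the polar part,
  \<open>D = - (\<alpha>\<delta> - \<beta>\<gamma>) / \<gamma>\<^sup>2\<close>, does not vanish because the fraction is not constant.\<close>

lemma card_le_if_inj_on_fractional_linear_plus_id: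
  fixes \<alpha> \<beta> \<gamma> \<delta> :: "'a::{field,finite}"
  assumes det: "\<alpha> * \<delta> - \<beta> * \<gamma> \<noteq> 0" and "\<gamma> \<noteq> 0"
    and nz: "\<And>c. c \<in> S \<Longrightarrow> \<gamma> * c + \<delta> \<noteq> 0"
    and inj: "inj_on (\<lambda>c. (\<alpha> * c + \<beta>) / (\<gamma> * c + \<delta>) + c) S"
  shows "2 * card S \<le> CARD('a) + 1"
proof -
  define D where "D = (\<beta> * \<gamma> - \<alpha> * \<delta>) / \<gamma>^2"
  have "D \<noteq> 0" using det \<open>\<gamma> \<noteq> 0\<close> by (simp add: D_def)
  let ?u = "\<lambda>c. c + \<delta> / \<gamma>"
  have u: "?u c = (\<gamma> * c + \<delta>) / \<gamma>" for c
    using \<open>\<gamma> \<noteq> 0\<close> by (simp add: field_simps)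
  have eq: "?u c + D / ?u c = (\<alpha> * c + \<beta>) / (\<gamma> * c + \<delta>) + c + (\<delta> / \<gamma> - \<alpha> / \<gamma>)"
    if "c \<in> S" for c
  proof -
    define w where "w = \<gamma> * c + \<delta>"
    have w: "w \<noteq> 0" using nz[OF that] by (simp add: w_def)
    have "D / ?u c + \<alpha> / \<gamma> = (\<beta> * \<gamma> - \<alpha> * \<delta> + \<alpha> * w) / (\<gamma> * w)"
      unfolding u D_def w_def[symmetric] using w \<open>\<gamma> \<noteq> 0\<close>
      by (simp add: add_divide_distrib power2_eq_square)
    also have "\<beta> * \<gamma> - \<alpha> * \<delta> + \<alpha> * w = \<gamma> * (\<alpha> * c + \<beta>)"
      by (simp add: w_def algebra_simps)
    finally have "D / ?u c + \<alpha> / \<gamma> = (\<alpha> * c + \<beta>) / (\<gamma> * c + \<delta>)"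
      using \<open>\<gamma> \<noteq> 0\<close> by (simp add: w_def)
    then have "D / ?u c = (\<alpha> * c + \<beta>) / (\<gamma> * c + \<delta>) - \<alpha> / \<gamma>"
      by (simp only: eq_diff_eq)
    then show ?thesis by simp
  qed
  have "inj_on (\<lambda>u. u + D / u) (?u ` S)"
  proof (rule inj_onI, elim imageE)
    fix x y c d
    assume xy: "x = ?u c" "y = ?u d" and S: "c \<in> S" "d \<in> S" and "x + D / x = y + D / y"
    then have "(\<alpha> * c + \<beta>) / (\<gamma> * c + \<delta>) + c = (\<alpha> * d + \<beta>) / (\<gamma> * d + \<delta>) + d"
      by (simp only: xy eq[OF S(1)] eq[OF S(2)] add_right_cancel)
    then show "x = y"
      using inj_onD[OF inj] S xy by blast
  qed
  moreover have "0 \<notin> ?u ` S"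
    using nz \<open>\<gamma> \<noteq> 0\<close> unfolding u by auto
  ultimately have "2 * card (?u ` S) \<le> CARD('a) + 1"
    using card_le_if_inj_on_plus_divide[OF \<open>D \<noteq> 0\<close>] by blast
  then show ?thesis by (simp add: card_image)
qed

lemma card_le_linearity:
  fixes f :: "'a::{field,finite} poly"
  assumes "\<And>c. c \<in> S \<Longrightarrow> poly f c = a * c + b"
  shows "card S \<le> linearity f"
proof -
  have "card S \<le> card {c. poly f c = a * c + b}"
    using assms by (intro card_mono) auto
  also have "\<dots> \<le> linearity f"
    unfolding linearity_def by (intro Max_ge) auto
  finally show ?thesis .
qed

section \<open>Complete mappings\<close>

text \<open>Over the field with two elements, \<open>f(1) = f(0) + 1\<close> for every permutation \<open>f\<close>, so
  that \<open>f(x) + x\<close> takes the same value at \<open>0\<close> and \<open>1\<close>.\<close>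

lemma complete_mapping_card_ge_3:
  fixes f :: "'a::{field,finite} poly"
  assumes "complete_mapping f"
  shows "CARD('a) \<ge> 3"
proof (rule ccontr)
  assume "\<not> ?thesis"
  then have "card (UNIV :: 'a set) \<le> card {0, 1 :: 'a}" by simp
  then have univ: "UNIV = {0, 1 :: 'a}"
    by (metis card_seteq finite subset_UNIV)
  have "(1 :: 'a) + 1 \<in> {0, 1}" unfolding univ[symmetric] by simp
  then have two: "(1 :: 'a) + 1 = 0"
    by (metis add_cancel_right_right insertE one_neq_zero singletonD)
  have "inj (poly f)" and "inj (poly (f + [:0, 1:]))"
    using assms by (simp_all only: complete_mapping_def permutation_poly_def bij_def)
  then have "poly f 0 \<noteq> poly f 1" and "poly f 0 \<noteq> poly f 1 + 1"
    using injD[of "poly f" 0 1] injD[of "poly (f + [:0, 1:])" 0 1] by auto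
  moreover have "poly f 0 \<in> {0, 1}" "poly f 1 \<in> {0, 1}"
    unfolding univ[symmetric] by simp_all
  ultimately show False using two by auto
qed

theorem theorem1:
  fixes f :: "'a::{field,finite} poly"
  assumes "CARD('a) \<noteq> 3"
    and "complete_mapping f"
  shows "linearity f \<ge> (CARD('a) + 5) div 2 \<or> carlitz_rank f \<ge> CARD('a) div 2"
proof (rule disjCI)
  let ?n = "carlitz_rank f"
  assume "\<not> ?n \<ge> CARD('a) div 2"
  then have n: "?n < CARD('a) div 2" by simp
  have q: "CARD('a) \<ge> 3" using complete_mapping_card_ge_3[OF assms(2)] .
  have "poly (f + [:0, 1:]) = (\<lambda>c. poly f c + c)"
    by (simp add: fun_eq_iff)
  then have perm: "permutation_poly f" and inj: "inj (\<lambda>c. poly f c + c)"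
    using assms(2) by (auto simp only: complete_mapping_def permutation_poly_def bij_def)
  obtain a where a: "carlitz_coeffs ?n a" "poly (carlitz_poly ?n a) = poly f"
    using carlitz_rank_attained[OF q perm] .
  have "a 0 \<noteq> 0" using a(1) by (simp add: carlitz_coeffs_def)
  then obtain \<alpha> \<beta> \<gamma> \<delta> E where det: "\<alpha> * \<delta> - \<beta> * \<gamma> \<noteq> 0"
    and card: "card E \<le> (if \<gamma> = 0 then ?n - 1 else ?n)"
    and eq: "\<And>c. c \<notin> E \<Longrightarrow> \<gamma> * c + \<delta> \<noteq> 0 \<and> poly f c = (\<alpha> * c + \<beta>) / (\<gamma> * c + \<delta>)"
    using carlitz_poly_fractional_linear[OF q, of a ?n] unfolding a(2) by blast
  have card_compl: "card (- E) = CARD('a) - card E"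
    by (simp add: card_Diff_subset Compl_eq_Diff_UNIV)
  show "linearity f \<ge> (CARD('a) + 5) div 2"
  proof (cases "\<gamma> = 0")
    case True
    have "poly f c = (\<alpha> / \<delta>) * c + \<beta> / \<delta>" if "c \<in> - E" for c
      using eq[of c] that True by (simp add: add_divide_distrib)
    then have "card (- E) \<le> linearity f"
      by (rule card_le_linearity)
    moreover have "card E \<le> ?n - 1" using card True by simp
    \<comment> \<open>For \<open>n = 0\<close> the whole field remains, and \<open>q \<ge> \<lfloor>(q + 5)/2\<rfloor>\<close> holds from \<open>q = 4\<close> on.\<close>
    ultimately show ?thesis
      using n q assms(1) card_compl by linarith
  next
    case False
    have "inj_on (\<lambda>c. (\<alpha> * c + \<beta>) / (\<gamma> * c + \<delta>) + c) (- E)"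
      using inj_on_subset[OF inj subset_UNIV] eq
      by (subst inj_on_cong[of _ _ "\<lambda>c. poly f c + c"]) auto
    then have "2 * card (- E) \<le> CARD('a) + 1"
      using det False eq by (intro card_le_if_inj_on_fractional_linear_plus_id) auto
    moreover have "card E \<le> ?n" using card False by simp
    \<comment> \<open>Now \<open>2 (q - n) \<le> q + 1\<close>, that is \<open>q \<le> 2 n + 1\<close>, against \<open>n < \<lfloor>q/2\<rfloor>\<close>.\<close>
    ultimately show ?thesis
      using n card_compl by linarith
  qed
qed

end
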